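(* There exist $n_0\in\mathbb N$ and a constant $L$, not depending on $j$ and $n$ (nor on the iteration number $k$), such that for all $n\ge n_0$ the following holds. 1) For each $j\in\{1,\dots,[\frac{n+1}{2}]\}$ the equation $\tan\left(\frac{n+3}{2}\varphi\right)=f(\varphi)$ has exactly one root $\varphi_{2j-1}$ on the interval $\left(\frac{\pi(2j-1)}{n+3},\frac{\pi(2j+1)}{n+3}\right)$. Moreover, for the iterations $$\varphi_{2j-1}^{(0)}=d_{2j-1},\qquad \varphi_{2j-1}^{(k+1)}=\frac{2}{n+3}\left[\pi j+\arctan f(\varphi_{2j-1}^{(k)})\right]$$ one has, for every iteration number $k\ge 0$, $$\left|\varphi_{2j-1}^{(k+1)}-\varphi_{2j-1}^{(k)}\right|\le\frac{L}{n+3}(0.8)^k.$$ 2) For each $j\in\{1,\dots,[\frac{n}{2}]\}$ the equation $\tan\left(\frac{n+3}{2}\varphi\right)=\frac{1}{h(\varphi)}$ has exactly one root $\varphi_{2j}$ on the interval $\left(\frac{2\pi j}{n+3},\frac{2\pi(j+1)}{n+3}\right)$. Moreover, for the iterations $$\varphi_{2j}^{(0)}=d_{2j},\qquad \varphi_{2j}^{(k+1)}=\frac{2}{n+3}\left[\pi j+\frac{\pi}{2}-\arctan h(\varphi_{2j}^{(k)})\right]$$ one has, for every iteration number $k\ge 0$, $$\left|\varphi_{2j}^{(k+1)}-\varphi_{2j}^{(k)}\right|\le\frac{L}{n+3}(0.8)^k.$$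
   Context: $d_m=\frac{\pi(m+1)}{n+3}$ for $m=1,\dots,n$; $[x]$ is the integer part of $x$. $\beta:[0,\pi]\to\mathbb C$ is the regular branch of $\arccos\bigl(1-(1-\cos\varphi)e^{2\pi i/3}\bigr)$ determined as follows: $\beta$ is continuous, $\beta(0)=0$, $\cos\beta(\varphi)=1-(1-\cos\varphi)e^{2\pi i/3}$, and for $\varphi\in(0,\pi)$ one has $\sin\beta(\varphi)=B_s(\varphi)e^{i\psi_s(\varphi)}$ with $B_s(\varphi)>0$ and $\psi_s(\varphi)\in(\frac{\pi}{4},\frac{\pi}{3})$. For $\varphi\in(0,\pi)$ put $c(\varphi)=\Re\beta(\varphi)$, $b(\varphi)=\Im\beta(\varphi)$, $B(\varphi)=\Re\bigl(\sin(\beta(\varphi))e^{-\pi i/3}\bigr)$, $C(\varphi)=-\Im\bigl(\sin(\beta(\varphi))e^{-\pi i/3}\bigr)$, and $$f(\varphi)=2\,\frac{B(\varphi)\sin((n+3)c(\varphi))+C(\varphi)\sinh((n+3)b(\varphi))}{\sin(\varphi)\,\bigl(\cos((n+3)c(\varphi))+\cosh((n+3)b(\varphi))\bigr)},$$ $$h(\varphi)=2\,\frac{B(\varphi)\sin((n+3)c(\varphi))-C(\varphi)\sinh((n+3)b(\varphi))}{\sin(\varphi)\,\bigl(-\cos((n+3)c(\varphi))+\cosh((n+3)b(\varphi))\bigr)}.$$ Convention: in the equation $\tan(\frac{n+3}{2}\varphi)=1/h(\varphi)$, a point where $h(\varphi)=0$ and $\cos(\frac{n+3}{2}\varphi)=0$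 (both sides infinite) is regarded as a solution, i.e. the equation means $\cos(\frac{n+3}{2}\varphi)=h(\varphi)\sin(\frac{n+3}{2}\varphi)$. *)

theory Defs
  imports "HOL-Analysis.Analysis"
begin

definition regular_branch :: "(real \<Rightarrow> complex) \<Rightarrow> bool" where
  "regular_branch \<beta> \<longleftrightarrow>
     continuous_on {0..pi} \<beta> \<and>
     \<beta> 0 = 0 \<and>
     (\<forall>\<phi>\<in>{0..pi}. cos (\<beta> \<phi>) = 1 - of_real (1 - cos \<phi>) * cis (2 * pi / 3)) \<and>
     (\<forall>\<phi>\<in>{0<..<pi}. \<exists>B\<^sub>s \<psi>\<^sub>s. B\<^sub>s > 0 \<and> \<psi>\<^sub>s \<in> {pi / 4<..<pi / 3} \<and>
        sin (\<beta> \<phi>) = of_real B\<^sub>s * cis \<psi>\<^sub>s)"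

definition c_part :: "(real \<Rightarrow> complex) \<Rightarrow> real \<Rightarrow> real" where
  "c_part \<beta> \<phi> = Re (\<beta> \<phi>)"

definition b_part :: "(real \<Rightarrow> complex) \<Rightarrow> real \<Rightarrow> real" where
  "b_part \<beta> \<phi> = Im (\<beta> \<phi>)"

definition B_part :: "(real \<Rightarrow> complex) \<Rightarrow> real \<Rightarrow> real" where
  "B_part \<beta> \<phi> = Re (sin (\<beta> \<phi>) * cis (- pi / 3))"

definition C_part :: "(real \<Rightarrow> complex) \<Rightarrow> real \<Rightarrow> real" where
  "C_part \<beta> \<phi> = - Im (sin (\<beta> \<phi>) * cis (- pi / 3))"

definition f_fun :: "(real \<Rightarrow> complex) \<Rightarrow> nat \<Rightarrow> real \<Rightarrow> real" where
  "f_fun \<beta> n \<phi> =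
     2 * ((B_part \<beta> \<phi> * sin (real (n + 3) * c_part \<beta> \<phi>)
           + C_part \<beta> \<phi> * sinh (real (n + 3) * b_part \<beta> \<phi>))
        / (sin \<phi> * (cos (real (n + 3) * c_part \<beta> \<phi>) + cosh (real (n + 3) * b_part \<beta> \<phi>))))"

definition h_fun :: "(real \<Rightarrow> complex) \<Rightarrow> nat \<Rightarrow> real \<Rightarrow> real" where
  "h_fun \<beta> n \<phi> =
     2 * ((B_part \<beta> \<phi> * sin (real (n + 3) * c_part \<beta> \<phi>)
           - C_part \<beta> \<phi> * sinh (real (n + 3) * b_part \<beta> \<phi>))
        / (sin \<phi> * (- cos (real (n + 3) * c_part \<beta> \<phi>) + cosh (real (n + 3) * b_part \<beta> \<phi>))))"

definition d_node :: "nat \<Rightarrow> nat \<Rightarrow> real" where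
  "d_node n m = pi * (real m + 1) / real (n + 3)"

text \<open>The iterates \<open>k \<mapsto> \<phi>\<^sup>(\<^sup>k\<^sup>)\<close> with index \<open>2j - 1\<close> (used only for \<open>j \<ge> 1\<close>, so the
  subtraction does not truncate) and with index \<open>2j\<close>.\<close>

primrec odd_iter :: "(real \<Rightarrow> complex) \<Rightarrow> nat \<Rightarrow> nat \<Rightarrow> nat \<Rightarrow> real" where
  "odd_iter \<beta> n j 0 = d_node n (2 * j - 1)"
| "odd_iter \<beta> n j (Suc k) =
     2 / real (n + 3) * (pi * real j + arctan (f_fun \<beta> n (odd_iter \<beta> n j k)))"

primrec even_iter :: "(real \<Rightarrow> complex) \<Rightarrow> nat \<Rightarrow> nat \<Rightarrow> nat \<Rightarrow> real" where
  "even_iter \<beta> n j 0 = d_node n (2 * j)"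
| "even_iter \<beta> n j (Suc k) =
     2 / real (n + 3) * (pi * real j + pi / 2 - arctan (h_fun \<beta> n (even_iter \<beta> n j k)))"

text \<open>The equation \<open>tan ((n+3)/2 \<phi>) = 1 / h(\<phi>)\<close>, where a point at which both sides are infinite
  counts as a solution. Neither \<open>tan\<close> nor \<open>1 / h\<close> can be used directly, because in HOL
  \<open>tan x = 0\<close> where \<open>cos x = 0\<close>, and \<open>1 / 0 = 0\<close>.\<close>

definition even_equation :: "(real \<Rightarrow> complex) \<Rightarrow> nat \<Rightarrow> real \<Rightarrow> bool" where
  "even_equation \<beta> n \<phi> \<longleftrightarrow>
     cos (real (n + 3) / 2 * \<phi>) = h_fun \<beta> n \<phi> * sin (real (n + 3) / 2 * \<phi>)"

text \<open>The branch exists and is unique on \<open>[0, \<pi>]\<close>, so that quantifying over all \<open>\<beta>\<close> with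
  \<open>regular_branch \<beta>\<close> is neither vacuous nor more general than fixing the branch.\<close>

lemma sector_polar:
  assumes "0 < Re s" "Re (s\<^sup>2) < 0" "- sqrt 3 * Re (s\<^sup>2) < Im (s\<^sup>2)"
  shows "\<exists>r \<psi>. r > 0 \<and> \<psi> \<in> {pi / 4<..<pi / 3} \<and> s = of_real r * cis \<psi>"
proof -
  define x y where "x = Re s" and "y = Im s"
  have x: "x > 0" using assms by (simp add: x_def)
  have 1: "x\<^sup>2 < y\<^sup>2" using assms(2) by (simp add: Re_power2 x_def y_def)
  have 2: "sqrt 3 * (y\<^sup>2 - x\<^sup>2) < 2 * x * y"
    using assms(3) by (simp add: Re_power2 Im_power2 x_def y_def algebra_simps)
  have "0 < 2 * x * y" using 1 2 by (smt (verit) mult_pos_pos real_sqrt_gt_zero)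
  then have y: "y > 0" using x by (simp add: zero_less_mult_iff)
  have xy: "x < y" using 1 y by (meson less_imp_le power2_less_imp_less)
  have "(sqrt 3 * y + x) * (y - sqrt 3 * x) = sqrt 3 * (y\<^sup>2 - x\<^sup>2) - 2 * x * y"
    by (simp add: algebra_simps power2_eq_square)
  then have "(sqrt 3 * y + x) * (y - sqrt 3 * x) < 0" using 2 by simp
  moreover have "sqrt 3 * y + x > 0" using x y by (simp add: add_pos_pos)
  ultimately have yx: "y < sqrt 3 * x" by (simp add: mult_less_0_iff)
  have "Arg s = arctan (y / x)" unfolding x_def y_def using x by (intro arg_conv_arctan) (simp add: x_def)
  moreover have "arctan 1 < arctan (y / x)" using x xy by (simp only: arctan_less_iff) simp
  moreover have "arctan (y / x) < arctan (sqrt 3)"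
    using x yx by (simp only: arctan_less_iff) (simp add: field_simps)
  moreover have "arctan (sqrt 3) = pi / 3"
    by (rule arctan_unique) (use pi_gt_zero in \<open>simp_all add: tan_60 field_simps\<close>)
  ultimately have "Arg s \<in> {pi / 4<..<pi / 3}" by simp
  moreover have "s = of_real (cmod s) * cis (Arg s)" by (metis rcis_cmod_Arg rcis_def)
  moreover have "cmod s > 0" using x by (auto simp: x_def)
  ultimately show ?thesis by blast
qed

lemma regular_branch_exists: "\<exists>\<beta>. regular_branch \<beta>"
proof -
  define z where "z \<phi> = 1 - of_real (1 - cos \<phi>) * cis (2 * pi / 3)" for \<phi> :: real
  have cis: "cis (2 * pi / 3) = Complex (- 1 / 2) (sqrt 3 / 2)"
    by (simp add: cis.ctr cos_120 sin_120)
  have Rez: "Re (z \<phi>) = 1 + (1 - cos \<phi>) / 2" and Imz: "Im (z \<phi>) = - sqrt 3 / 2 * (1 - cos \<phi>)" for \<phi>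
    by (simp_all add: z_def cis)
  have Re_pos: "Re (z \<phi>) > 0" for \<phi> using cos_le_one[of \<phi>] unfolding Rez by (simp add: add_pos_nonneg)
  have contz: "isCont z \<phi>" for \<phi> unfolding z_def by (intro continuous_intros)
  have z0: "z 0 = 1" by (simp add: z_def)
  have cospos: "cos \<phi> < 1" if "\<phi> \<in> {0<..pi}" for \<phi>
    using cos_monotone_0_pi[of 0 \<phi>] that by simp
  have "isCont (\<lambda>\<phi>. Arccos (z \<phi>)) \<phi>" if "\<phi> \<in> {0..pi}" for \<phi>
  proof (cases "\<phi> = 0")
    case False
    then have "Im (z \<phi>) \<noteq> 0" using cospos[of \<phi>] that by (simp add: Imz)
    then show ?thesis using contz by (intro isCont_Arccos') auto
  next
    case True
    have "((\<lambda>\<phi>. cmod (csqrt (1 - (z \<phi>)\<^sup>2))) \<longlongrightarrow> sqrt (cmod (1 - (z 0)\<^sup>2))) (at 0)"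
      unfolding norm_csqrt using contz[of 0] by (intro tendsto_intros) (simp add: isCont_def)
    then have "((\<lambda>\<phi>. csqrt (1 - (z \<phi>)\<^sup>2)) \<longlongrightarrow> 0) (at 0)"
      by (simp add: z0 tendsto_norm_zero_iff del: norm_csqrt)
    then have "((\<lambda>\<phi>. z \<phi> + \<i> * csqrt (1 - (z \<phi>)\<^sup>2)) \<longlongrightarrow> 1 + \<i> * 0) (at 0)"
      using contz[of 0] by (intro tendsto_intros) (auto simp: isCont_def z0)
    then have "((\<lambda>\<phi>. Arccos (z \<phi>)) \<longlongrightarrow> - \<i> * Ln (1 + \<i> * 0)) (at 0)"
      unfolding Arccos_def by (intro tendsto_mult[OF tendsto_const] tendsto_Ln) auto
    then show ?thesis by (simp add: True isCont_def z0)
  qed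
  then have 1: "continuous_on {0..pi} (\<lambda>\<phi>. Arccos (z \<phi>))"
    by (simp add: continuous_at_imp_continuous_on)
  have 2: "\<exists>r \<psi>. r > 0 \<and> \<psi> \<in> {pi / 4<..<pi / 3} \<and> sin (Arccos (z \<phi>)) = of_real r * cis \<psi>"
    if "\<phi> \<in> {0<..<pi}" for \<phi>
  proof (rule sector_polar)
    define t where "t = 1 - cos \<phi>"
    have t: "0 < t" "t < 2"
      using cospos[of \<phi>] cos_monotone_0_pi[of \<phi> pi] that by (auto simp: t_def)
    have s: "sin (Arccos (z \<phi>)) = csqrt (1 - (z \<phi>)\<^sup>2)" using Re_pos by (simp add: sin_Arccos)
    have R: "Re (1 - (z \<phi>)\<^sup>2) = - t * (1 - t / 2)"
      by (simp add: Re_power2 Rez Imz flip: t_def) (simp add: power2_eq_square field_simps)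
    have I: "Im (1 - (z \<phi>)\<^sup>2) = sqrt 3 * (t + t\<^sup>2 / 2)"
      by (simp add: Im_power2 Rez Imz flip: t_def) (simp add: power2_eq_square field_simps)
    have "t * (1 - t / 2) > 0" using t by simp
    then show R0: "Re ((sin (Arccos (z \<phi>)))\<^sup>2) < 0" unfolding s power2_csqrt R by simp
    have "sqrt 3 * (t * (1 - t / 2)) < sqrt 3 * (t + t\<^sup>2 / 2)"
      using t by (intro mult_strict_left_mono) (auto simp: power2_eq_square algebra_simps)
    then show "- sqrt 3 * Re ((sin (Arccos (z \<phi>)))\<^sup>2) < Im ((sin (Arccos (z \<phi>)))\<^sup>2)"
      unfolding s power2_csqrt R I by simp
    have "Im (1 - (z \<phi>)\<^sup>2) > 0" unfolding I using t by (simp add: add_pos_pos)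
    then have "Re (csqrt (1 - (z \<phi>)\<^sup>2)) \<noteq> 0"
      by (metis Im_power2 less_irrefl mult_zero_left mult_zero_right power2_csqrt)
    then show "0 < Re (sin (Arccos (z \<phi>)))" unfolding s
      using csqrt_principal[of "1 - (z \<phi>)\<^sup>2"] by blast
  qed
  have "regular_branch (\<lambda>\<phi>. Arccos (z \<phi>))"
    unfolding regular_branch_def using 1 2 by (auto simp: z0) (simp_all add: z_def)
  then show ?thesis by blast
qed

lemma regular_branch_unique:
  assumes "regular_branch \<beta>" "regular_branch \<gamma>" "\<phi> \<in> {0..pi}"
  shows "\<beta> \<phi> = \<gamma> \<phi>"
proof -
  have sector: "Re w > 0" if "w = of_real r * cis \<psi>" "r > 0" "\<psi> \<in> {pi / 4<..<pi / 3}" for w r \<psi>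
    using that by (simp add: cos_gt_zero_pi)
  have same_exp: "exp (\<i> * \<beta> x) = exp (\<i> * \<gamma> x)" if x: "x \<in> {0<..<pi}" for x
  proof -
    have c: "cos (\<beta> x) = cos (\<gamma> x)" using assms x by (simp add: regular_branch_def)
    then have "(sin (\<beta> x))\<^sup>2 = (sin (\<gamma> x))\<^sup>2" by (simp add: sin_squared_eq)
    moreover have "Re (sin (\<delta> x)) > 0" if \<delta>: "regular_branch \<delta>" for \<delta>
    proof -
      obtain r \<psi> where "r > 0" "\<psi> \<in> {pi / 4<..<pi / 3}" "sin (\<delta> x) = of_real r * cis \<psi>"
        using \<delta> x unfolding regular_branch_def by blast
      then show ?thesis using sector by blast
    qed
    then have "Re (sin (\<beta> x)) > 0" "Re (sin (\<gamma> x)) > 0" using assms by blast+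
    ultimately have "sin (\<beta> x) = sin (\<gamma> x)" by (auto simp: power2_eq_iff)
    with c show ?thesis by (simp add: exp_Euler)
  qed
  define g where "g x = (\<beta> x - \<gamma> x) / (2 * of_real pi)" for x
  have cont: "continuous_on {0..pi} g"
    using assms unfolding regular_branch_def g_def by (intro continuous_intros) auto
  have g0: "g 0 = 0" using assms by (simp add: g_def regular_branch_def)
  have Ints: "g x \<in> \<int>" if x: "x \<in> {0<..<pi}" for x
  proof -
    obtain m :: int where "\<i> * \<beta> x = \<i> * \<gamma> x + of_int (2 * m) * pi * \<i>"
      using same_exp[OF x] unfolding exp_eq by blast
    then have "\<i> * (\<beta> x - \<gamma> x) = \<i> * (2 * of_int m * of_real pi)" by (simp add: algebra_simps)
    then have "\<beta> x - \<gamma> x = 2 * of_int m * of_real pi" by (simp only: mult_cancel_left) simp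
    then have "g x = of_int m" by (simp add: g_def)
    then show ?thesis by simp
  qed
  have "g constant_on {0<..<pi}"
  proof (rule continuous_discrete_range_constant)
    show "connected {0<..<pi}" by simp
    show "continuous_on {0<..<pi} g" using cont by (rule continuous_on_subset) auto
    show "\<exists>e>0. \<forall>y. y \<in> {0<..<pi} \<and> g y \<noteq> g x \<longrightarrow> e \<le> norm (g y - g x)" if "x \<in> {0<..<pi}" for x
    proof (intro exI[of _ 1] conjI allI impI)
      fix y assume y: "y \<in> {0<..<pi} \<and> g y \<noteq> g x"
      have "g y - g x \<in> \<int>" using Ints y that by (intro Ints_diff) auto
      then obtain m :: int where "g y - g x = of_int m" by (rule Ints_cases)
      moreover from this have "m \<noteq> 0" using y by auto
      then have "1 \<le> \<bar>real_of_int m\<bar>" by linarith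
      ultimately show "1 \<le> norm (g y - g x)" by (simp only: norm_of_int)
    qed simp
  qed
  then obtain a where a: "\<And>x. x \<in> {0<..<pi} \<Longrightarrow> g x = a" by (auto simp: constant_on_def)
  have "g x = a" if "x \<in> closure {0<..<pi}" for x
    by (rule continuous_constant_on_closure[OF _ a that]) (use cont in auto)
  then have "g \<phi> = g 0" using assms(3) pi_gt_zero by (simp)
  then show ?thesis using g0 by (simp add: g_def)
qed

end

theory Submission
  imports Defs "HOL-Real_Asymp.Real_Asymp"
begin

text \<open>
  Half angles make the branch explicit: since \<open>1 - cos x = 2 sin\<^sup>2 (x/2)\<close>, the defining equation says
  \<open>sin (\<beta>/2) = \<plusminus> exp (\<i>\<pi>/3) sin (\<phi>/2)\<close>, and the sector condition selects
  \<open>\<beta> = 2 Arcsin (exp (\<i>\<pi>/3) sin (\<phi>/2))\<close> (\<open>half_branch_regular\<close> and the uniqueness of the branch).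
  Write \<open>cos (\<beta>/2) = u - \<i> v\<close>, \<open>\<beta> = c + \<i> b\<close>, \<open>p = cos (\<phi>/2)\<close>, \<open>N = n + 3\<close>. Then
  \<open>B = 2 u sin (\<phi>/2)\<close> and \<open>C = 2 v sin (\<phi>/2)\<close>, the factor \<open>sin (\<phi>/2)\<close> cancels against
  \<open>sin \<phi>\<close>, and both functions come from one family,
  \<open>f = G\<^sub>0 / p\<close> and \<open>h = - G\<^sub>\<pi> / p\<close>, where
    \<open>G\<^sub>\<theta> = 2 (u sin (N c + \<theta>) + v sinh (N b)) / (cos (N c + \<theta>) + cosh (N b))\<close>.
  Both equations become the fixed-point equation of \<open>\<phi> \<mapsto> (2/N) (a + arctan (G\<^sub>\<theta> / p))\<close>, with
  \<open>a = \<pi> j\<close>, \<open>\<theta> = 0\<close> in the odd case and \<open>a = \<pi> j + \<pi>/2\<close>, \<open>\<theta> = \<pi>\<close> in the even case.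
  This map takes values in the open interval of radius \<open>\<pi>/N\<close> about the starting point \<open>2a/N\<close> of
  the iteration. If it contracts by the factor \<open>0.8\<close> there, Banach's theorem gives the unique root, and since the first step is at most
  \<open>\<pi>/N\<close>, the step estimate holds with \<open>L = \<pi>\<close> (\<open>arctan_iteration\<close>).

  So everything rests on \<open>\<bar>(arctan (G/p))'\<bar> \<le> 0.4 N\<close> on \<open>[\<pi>/N, \<pi> - \<pi>/N]\<close> for large \<open>N\<close>. Here
  \<open>(arctan (G/p))' = (G' p - G p') / (p\<^sup>2 + G\<^sup>2)\<close>. The identity
  \<open>\<beta>' cos (\<beta>/2) = exp (\<i>\<pi>/3) p\<close> collapses the part of \<open>G'\<close> that grows with \<open>N\<close> to
    \<open>N p (1 + cos cosh - \<surd>3 sin sinh) / (cos + cosh)\<^sup>2\<close>,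
  where \<open>cos\<close>, \<open>sin\<close> are taken at \<open>N c + \<theta>\<close> and \<open>cosh\<close>, \<open>sinh\<close> at \<open>N b\<close>. Its coefficient of
  \<open>N p\<close> is at most \<open>(1 + 2 X) / (X - 1)\<^sup>2\<close> in absolute value with \<open>X = cosh (N b)\<close>. From
  \<open>sinh (b/2) \<ge> (\<surd>3/2) sin (\<phi>/2)\<close> and \<open>\<phi> \<ge> \<pi>/N\<close> one gets a lower bound for \<open>N b\<close> that tends
  to \<open>\<pi>\<surd>3/2 > 2.7\<close>; so \<open>X \<ge> 7.4\<close> for large \<open>N\<close>, and the fraction is at most \<open>0.39\<close>; the remaining
  factor \<open>p\<^sup>2 / (p\<^sup>2 + G\<^sup>2)\<close> is at most \<open>1\<close>. All other
  terms are bounded uniformly in \<open>N\<close>, because \<open>p\<^sup>2 + G\<^sup>2\<close> stays away from \<open>0\<close>: near \<open>\<phi> = \<pi>\<close>, where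
  \<open>p\<close> vanishes, \<open>v\<close> and hence \<open>G\<close> is bounded below. The gap between \<open>0.39\<close> and \<open>0.4\<close> absorbs them.
\<close>

section \<open>The branch in closed form\<close>

definition half_branch :: "real \<Rightarrow> complex" where
  "half_branch \<phi> = Arcsin (cis (pi / 3) * of_real (sin (\<phi> / 2)))"

definition u_part :: "real \<Rightarrow> real" where
  "u_part \<phi> = Re (cos (half_branch \<phi>))"

definition v_part :: "real \<Rightarrow> real" where
  "v_part \<phi> = - Im (cos (half_branch \<phi>))"

lemma cis_pi_third: "cis (pi / 3) = Complex (1 / 2) (sqrt 3 / 2)"
  by (simp add: cis.ctr cos_60 sin_60)

lemma cis_pi_third_power2: "(cis (pi / 3))\<^sup>2 = cis (2 * pi / 3)"
  by (simp add: power2_eq_square cis_mult)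

lemma cis_two_pi_third: "cis (2 * pi / 3) = Complex (- 1 / 2) (sqrt 3 / 2)"
  by (simp add: cis.ctr cos_120 sin_120)

lemma abs_Re_half_sine: "\<bar>Re (cis (pi / 3) * of_real (sin x))\<bar> < 1"
proof -
  have "\<bar>sin x\<bar> < 2" using abs_sin_le_one[of x] by linarith
  then show ?thesis by (simp add: cis_pi_third)
qed

lemma sin_half_branch: "sin (half_branch \<phi>) = cis (pi / 3) * of_real (sin (\<phi> / 2))"
  by (simp add: half_branch_def)

lemma Re_half_branch: "\<bar>Re (half_branch \<phi>)\<bar> < pi / 2"
  unfolding half_branch_def by (rule Arcsin_bounds[OF abs_Re_half_sine])

lemma cos_Re_half_branch: "cos (Re (half_branch \<phi>)) > 0"
  using Re_half_branch[of \<phi>] by (intro cos_gt_zero_pi) auto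

text \<open>
  The real and imaginary parts of this square give \<open>u\<^sup>2 - v\<^sup>2\<close> and \<open>u v\<close>; every bound on \<open>u\<close> and
  \<open>v\<close> below comes from these and from \<open>u > 0\<close>, without solving for them.
\<close>

lemma cos_half_branch_power2:
  "(cos (half_branch \<phi>))\<^sup>2 = 1 - cis (2 * pi / 3) * of_real ((sin (\<phi> / 2))\<^sup>2)"
  by (simp add: cos_squared_eq sin_half_branch power_mult_distrib cis_pi_third_power2)

lemma u_part_pos: "u_part \<phi> > 0"
  unfolding u_part_def Re_cos using cos_Re_half_branch[of \<phi>] by (simp add: add_pos_pos)

lemma cos_half_branch_eq: "cos (half_branch \<phi>) = Complex (u_part \<phi>) (- v_part \<phi>)"
  by (simp add: u_part_def v_part_def complex_eq_iff)

lemma cos_half_branch_nz: "cos (half_branch \<phi>) \<noteq> 0"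
  using u_part_pos[of \<phi>] by (auto simp: u_part_def)

lemma uv_Re: "(u_part \<phi>)\<^sup>2 - (v_part \<phi>)\<^sup>2 = 1 + (sin (\<phi> / 2))\<^sup>2 / 2"
  and uv_Im: "2 * u_part \<phi> * v_part \<phi> = sqrt 3 / 2 * (sin (\<phi> / 2))\<^sup>2"
proof -
  have "(Complex (u_part \<phi>) (- v_part \<phi>))\<^sup>2
      = 1 - Complex (- 1 / 2) (sqrt 3 / 2) * of_real ((sin (\<phi> / 2))\<^sup>2)"
    using cos_half_branch_power2[of \<phi>] by (simp only: cos_half_branch_eq cis_two_pi_third)
  from arg_cong[OF this, of Re] arg_cong[OF this, of Im]
  show "(u_part \<phi>)\<^sup>2 - (v_part \<phi>)\<^sup>2 = 1 + (sin (\<phi> / 2))\<^sup>2 / 2"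
    and "2 * u_part \<phi> * v_part \<phi> = sqrt 3 / 2 * (sin (\<phi> / 2))\<^sup>2"
    by (simp_all add: Re_power2 Im_power2)
qed

lemma v_part_nonneg: "v_part \<phi> \<ge> 0"
proof -
  have "0 \<le> (2 * u_part \<phi>) * v_part \<phi>" unfolding uv_Im by simp
  then show ?thesis using u_part_pos[of \<phi>] by (simp add: zero_le_mult_iff)
qed

lemma u_part_ge_1: "u_part \<phi> \<ge> 1"
proof -
  have "1\<^sup>2 \<le> (u_part \<phi>)\<^sup>2" using uv_Re[of \<phi>] zero_le_power2[of "v_part \<phi>"]
    zero_le_power2[of "sin (\<phi> / 2)"] unfolding one_power2 by linarith
  then show ?thesis using u_part_pos[of \<phi>] by (meson less_imp_le power2_le_imp_le)
qed

lemma norm_cos_half_branch_le: "cmod (cos (half_branch \<phi>)) \<le> sqrt 2"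
proof -
  have s: "(sin (\<phi> / 2))\<^sup>2 \<le> 1" by (simp add: abs_square_le_1)
  have "(cmod (cos (half_branch \<phi>)))\<^sup>2 = cmod ((cos (half_branch \<phi>))\<^sup>2)" by (simp add: norm_power)
  also have "\<dots> \<le> cmod 1 + cmod (cis (2 * pi / 3) * of_real ((sin (\<phi> / 2))\<^sup>2))"
    unfolding cos_half_branch_power2 by (rule norm_triangle_ineq4)
  also have "\<dots> \<le> 2" using s by (simp add: norm_mult norm_power)
  finally show ?thesis by (rule real_le_rsqrt)
qed

lemma norm_cos_half_branch_ge: "cmod (cos (half_branch \<phi>)) \<ge> 1"
  using u_part_ge_1[of \<phi>] complex_Re_le_cmod[of "cos (half_branch \<phi>)"] by (simp add: u_part_def)

text \<open>
  The argument of \<open>Arcsin\<close> has real part of modulus below \<open>1\<close>, so it never meets the branch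
  cuts; this gives continuity. By \<open>sector_polar\<close> the sector for \<open>sin \<beta>\<close> can be checked on
  \<open>sin\<^sup>2 \<beta>\<close>, a polynomial in \<open>sin\<^sup>2 (\<phi>/2)\<close>, once the real part of \<open>sin \<beta>\<close> is known to be positive.
\<close>

lemma half_branch_regular: "regular_branch (\<lambda>\<phi>. 2 * half_branch \<phi>)"
  unfolding regular_branch_def
proof (intro conjI ballI)
  have "isCont half_branch \<phi>" for \<phi>
    unfolding half_branch_def[abs_def]
    using abs_Re_half_sine by (intro isCont_Arcsin' continuous_intros) auto
  then show "continuous_on {0..pi} (\<lambda>\<phi>. 2 * half_branch \<phi>)"
    by (intro continuous_intros) (simp add: continuous_at_imp_continuous_on)
  show "2 * half_branch 0 = 0" by (simp add: half_branch_def)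
next
  fix \<phi> :: real
  have "cos (2 * half_branch \<phi>) = 1 - 2 * (sin (half_branch \<phi>))\<^sup>2"
    by (simp add: cos_double_sin)
  also have "\<dots> = 1 - of_real (2 * (sin (\<phi> / 2))\<^sup>2) * cis (2 * pi / 3)"
    by (simp add: sin_half_branch power_mult_distrib cis_pi_third_power2 mult_ac)
  also have "2 * (sin (\<phi> / 2))\<^sup>2 = 1 - cos \<phi>"
    using cos_double_sin[of "\<phi> / 2"] by simp
  finally show "cos (2 * half_branch \<phi>) = 1 - of_real (1 - cos \<phi>) * cis (2 * pi / 3)" .
next
  fix \<phi> :: real assume \<phi>: "\<phi> \<in> {0<..<pi}"
  define q where "q = (sin (\<phi> / 2))\<^sup>2"
  have s: "sin (\<phi> / 2) > 0" using \<phi> by (intro sin_gt_zero) auto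
  then have q: "q > 0" by (simp add: q_def)
  have "cos (\<phi> / 2) > 0" using \<phi> by (intro cos_gt_zero_pi) auto
  then have "(cos (\<phi> / 2))\<^sup>2 > 0" by simp
  then have q1: "q < 1" by (simp add: q_def cos_squared_eq)
  have sin2: "sin (2 * half_branch \<phi>) = 2 * (cis (pi / 3) * of_real (sin (\<phi> / 2))) * Complex (u_part \<phi>) (- v_part \<phi>)"
    by (simp only: sin_double sin_half_branch cos_half_branch_eq)
  have "(sin (2 * half_branch \<phi>))\<^sup>2 = 4 * (cis (2 * pi / 3) * of_real q) * (1 - cis (2 * pi / 3) * of_real q)"
    by (simp add: sin_double power_mult_distrib sin_half_branch cos_half_branch_power2 cis_pi_third_power2 q_def)
  also have "\<dots> = Complex (- 2 * (q - q\<^sup>2)) (2 * sqrt 3 * (q + q\<^sup>2))"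
    unfolding cis_two_pi_third by (simp add: complex_eq_iff power2_eq_square algebra_simps)
  finally have sq: "(sin (2 * half_branch \<phi>))\<^sup>2 = Complex (- 2 * (q - q\<^sup>2)) (2 * sqrt 3 * (q + q\<^sup>2))" .
  show "\<exists>B\<^sub>s \<psi>\<^sub>s. B\<^sub>s > 0 \<and> \<psi>\<^sub>s \<in> {pi / 4<..<pi / 3} \<and>
        sin (2 * half_branch \<phi>) = of_real B\<^sub>s * cis \<psi>\<^sub>s"
  proof (rule sector_polar)
    have "0 < sin (\<phi> / 2) * (u_part \<phi> + sqrt 3 * v_part \<phi>)"
      using s u_part_pos[of \<phi>] v_part_nonneg[of \<phi>] by (intro mult_pos_pos add_pos_nonneg) auto
    then show "0 < Re (sin (2 * half_branch \<phi>))"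
      unfolding sin2 cis_pi_third by (simp add: field_simps)
    have "q\<^sup>2 < q" using q q1 by (simp add: power2_eq_square)
    then show "Re ((sin (2 * half_branch \<phi>))\<^sup>2) < 0" unfolding sq by simp
    have "sqrt 3 * (2 * (q - q\<^sup>2)) < sqrt 3 * (2 * (q + q\<^sup>2))"
      using q by (intro mult_strict_left_mono) auto
    then show "- sqrt 3 * Re ((sin (2 * half_branch \<phi>))\<^sup>2) < Im ((sin (2 * half_branch \<phi>))\<^sup>2)"
      unfolding sq complex.sel by linarith
  qed
qed

lemma regular_branch_eq_half_branch:
  assumes "regular_branch \<beta>" "\<phi> \<in> {0..pi}"
  shows "\<beta> \<phi> = 2 * half_branch \<phi>"
  using regular_branch_unique[OF assms(1) half_branch_regular assms(2)] .

lemma half_branch_deriv: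
  "(half_branch has_vector_derivative cis (pi / 3) * of_real (cos (\<phi> / 2)) / (2 * cos (half_branch \<phi>))) (at \<phi>)"
proof -
  have *: "((\<lambda>z. Arcsin (cis (pi / 3) * sin (z / 2))) has_field_derivative
      cis (pi / 3) * of_real (cos (\<phi> / 2)) / (2 * cos (half_branch \<phi>))) (at (of_real \<phi>))"
  proof -
    have e: "sin (complex_of_real \<phi> / 2) = of_real (sin (\<phi> / 2))"
            "cos (complex_of_real \<phi> / 2) = of_real (cos (\<phi> / 2))"
      by (simp_all flip: sin_of_real cos_of_real)
    show ?thesis
      using abs_Re_half_sine[of "\<phi> / 2"] unfolding half_branch_def e[symmetric]
      by (auto intro!: derivative_eq_intros simp: divide_simps)
  qed
  have e: "half_branch = (\<lambda>x. Arcsin (cis (pi / 3) * sin (complex_of_real x / 2)))"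
    by (simp add: half_branch_def fun_eq_iff flip: sin_of_real)
  show ?thesis
    by (subst e) (rule has_vector_derivative_real_field[OF *])
qed

lemma cos_half_branch_deriv:
  "((\<lambda>\<phi>. cos (half_branch \<phi>)) has_vector_derivative
     - (cis (2 * pi / 3) * of_real (sin (\<phi> / 2) * cos (\<phi> / 2)) / (2 * cos (half_branch \<phi>)))) (at \<phi>)"
proof -
  have "((cos \<circ> half_branch) has_vector_derivative
      cis (pi / 3) * of_real (cos (\<phi> / 2)) / (2 * cos (half_branch \<phi>)) * - sin (half_branch \<phi>)) (at \<phi>)"
    by (rule field_vector_diff_chain_at[OF half_branch_deriv DERIV_cos])
  moreover have "cis (pi / 3) * of_real (cos (\<phi> / 2)) / (2 * cos (half_branch \<phi>)) * - sin (half_branch \<phi>)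
     = - (cis (2 * pi / 3) * of_real (sin (\<phi> / 2) * cos (\<phi> / 2)) / (2 * cos (half_branch \<phi>)))"
    unfolding cis_pi_third_power2[symmetric] power2_eq_square by (simp add: sin_half_branch)
  ultimately show ?thesis by (simp only: o_def)
qed

lemma has_real_derivative_Re_Im:
  assumes "(f has_vector_derivative d) (at x)"
  shows "((\<lambda>x. Re (f x)) has_real_derivative Re d) (at x)"
    and "((\<lambda>x. Im (f x)) has_real_derivative Im d) (at x)"
  using bounded_linear.has_vector_derivative[OF bounded_linear_Re assms]
    bounded_linear.has_vector_derivative[OF bounded_linear_Im assms]
  by (simp_all add: has_real_derivative_iff_has_vector_derivative)

section \<open>The derivative of the quotient\<close>

text \<open>
  The two hypotheses on \<open>c'\<close>, \<open>b'\<close> are the real and imaginary parts of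
  \<open>(u - \<i> v) (c' + \<i> b') = exp (\<i>\<pi>/3) p\<close>. After \<open>sin\<^sup>2 + cos\<^sup>2 = 1\<close> and \<open>cosh\<^sup>2 - sinh\<^sup>2 = 1\<close>, the
  terms with factor \<open>N\<close> depend on \<open>u, v, c', b'\<close> through these two combinations only, so \<open>u\<close>
  and \<open>v\<close> disappear from the leading part.
\<close>

lemma trig_quotient_deriv:
  fixes u v c b :: "real \<Rightarrow> real" and N :: real
  assumes d: "(u has_real_derivative u') (at x)" "(v has_real_derivative v') (at x)"
      "(c has_real_derivative c') (at x)" "(b has_real_derivative b') (at x)"
    and cr1: "u x * c' + v x * b' = p / 2" and cr2: "u x * b' - v x * c' = sqrt 3 / 2 * p"
    and D: "cos (N * c x + \<theta>) + cosh (N * b x) \<noteq> 0"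
  shows "((\<lambda>x. 2 * (u x * sin (N * c x + \<theta>) + v x * sinh (N * b x)) / (cos (N * c x + \<theta>) + cosh (N * b x)))
     has_real_derivative
       N * p * (1 + cos (N * c x + \<theta>) * cosh (N * b x) - sqrt 3 * sin (N * c x + \<theta>) * sinh (N * b x))
           / (cos (N * c x + \<theta>) + cosh (N * b x))\<^sup>2
       + 2 * (u' * sin (N * c x + \<theta>) + v' * sinh (N * b x)) / (cos (N * c x + \<theta>) + cosh (N * b x))) (at x)"
proof -
  define S C Sh Ch where "S = sin (N * c x + \<theta>)" and "C = cos (N * c x + \<theta>)"
    and "Sh = sinh (N * b x)" and "Ch = cosh (N * b x)"
  have pyth: "S\<^sup>2 = 1 - C\<^sup>2" "Sh\<^sup>2 = Ch\<^sup>2 - 1"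
    by (simp_all add: S_def C_def Sh_def Ch_def sin_squared_eq sinh_square_eq)
  have nz: "C + Ch \<noteq> 0" using D by (simp add: C_def Ch_def)
  define R where "R = 2 * (u' * S + u x * (C * (N * c')) + (v' * Sh + v x * (Ch * (N * b'))))"
  define T where "T = 2 * (u x * S + v x * Sh)"
  have "((\<lambda>x. 2 * (u x * sin (N * c x + \<theta>) + v x * sinh (N * b x)) / (cos (N * c x + \<theta>) + cosh (N * b x)))
     has_real_derivative (R * (C + Ch) - T * (- S * (N * c') + Sh * (N * b'))) / ((C + Ch) * (C + Ch))) (at x)"
    unfolding R_def T_def S_def C_def Sh_def Ch_def
    by (rule derivative_eq_intros d refl D)+ (simp add: algebra_simps)
  moreover have "R * (C + Ch) - T * (- S * (N * c') + Sh * (N * b'))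
      = 2 * N * ((u x * c' + v x * b') * (1 + C * Ch) - (u x * b' - v x * c') * S * Sh)
         + 2 * (u' * S + v' * Sh) * (C + Ch)"
    unfolding R_def T_def using pyth by algebra
  moreover have cancel: "(2 * N * (p / 2 * E - sqrt 3 / 2 * p * S * Sh) + 2 * Y * D) / (D * D)
      = N * p * (E - sqrt 3 * S * Sh) / D\<^sup>2 + 2 * Y / D" if "D \<noteq> 0" for D E Y
    using that by (simp add: field_simps power2_eq_square)
  have "(2 * N * ((u x * c' + v x * b') * (1 + C * Ch) - (u x * b' - v x * c') * S * Sh)
         + 2 * (u' * S + v' * Sh) * (C + Ch)) / ((C + Ch) * (C + Ch))
      = N * p * (1 + C * Ch - sqrt 3 * S * Sh) / (C + Ch)\<^sup>2 + 2 * (u' * S + v' * Sh) / (C + Ch)"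
    unfolding cr1 cr2 using cancel[OF nz] by (simp only:)
  ultimately show ?thesis
    unfolding S_def[symmetric] C_def[symmetric] Sh_def[symmetric] Ch_def[symmetric] by (simp only:)
qed

text \<open>
  By Cauchy-Schwarz \<open>\<bar>C X - \<surd>3 S Sh\<bar>\<^sup>2 \<le> (C\<^sup>2 + S\<^sup>2) (X\<^sup>2 + 3 Sh\<^sup>2) \<le> 4 X\<^sup>2\<close>, so the leading
  coefficient is at most \<open>(1 + 2 X) / (X - 1)\<^sup>2\<close>, which is below \<open>0.39\<close> from \<open>X = 7.4\<close> on. The
  remaining terms have modulus at most \<open>3 + 4\<close>, and division by \<open>p\<^sup>2 + G\<^sup>2 \<ge> 1/100\<close> gives the \<open>700\<close>.
\<close>

lemma resonance_deriv_bound: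
  fixes N p p' u u' v v' S C Sh X G :: real
  assumes pyth: "S\<^sup>2 = 1 - C\<^sup>2" "Sh\<^sup>2 = X\<^sup>2 - 1"
    and Sh: "Sh \<ge> 0" and X: "X \<ge> 37/5" and N: "N \<ge> 0" and p: "0 \<le> p" "p \<le> 1"
    and bnd: "\<bar>u\<bar> \<le> 3/2" "\<bar>v\<bar> \<le> 3/2" "\<bar>u'\<bar> \<le> 1" "\<bar>v'\<bar> \<le> 1" "\<bar>p'\<bar> \<le> 1"
    and G: "G = 2 * (u * S + v * Sh) / (C + X)" and low: "p\<^sup>2 + G\<^sup>2 \<ge> 1/100"
  shows "\<bar>((N * p * (1 + C * X - sqrt 3 * S * Sh) / (C + X)\<^sup>2 + 2 * (u' * S + v' * Sh) / (C + X)) * p - G * p')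
           / (p\<^sup>2 + G\<^sup>2)\<bar> \<le> 39/100 * N + 700"
proof -
  have "C\<^sup>2 \<le> 1" "S\<^sup>2 \<le> 1" using pyth zero_le_power2[of S] zero_le_power2[of C] by linarith+
  then have CS: "\<bar>C\<bar> \<le> 1" "\<bar>S\<bar> \<le> 1" by (simp_all add: abs_square_le_1)
  have ShX: "Sh \<le> X" by (rule power2_le_imp_le) (use pyth X in auto)
  have D: "C + X \<ge> X - 1" "X - 1 > 0" using CS X by auto
  \<comment> \<open>Lagrange's identity for the vectors \<open>(C, - S)\<close> and \<open>(X, \<surd>3 Sh)\<close>\<close>
  have "(C * X - sqrt 3 * S * Sh)\<^sup>2 + (sqrt 3 * C * Sh + S * X)\<^sup>2 = (C\<^sup>2 + S\<^sup>2) * (X\<^sup>2 + (sqrt 3)\<^sup>2 * Sh\<^sup>2)"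
    by algebra
  also have "\<dots> \<le> (2 * X)\<^sup>2" using pyth by simp
  finally have "(C * X - sqrt 3 * S * Sh)\<^sup>2 \<le> (2 * X)\<^sup>2"
    using zero_le_power2[of "sqrt 3 * C * Sh + S * X"] by linarith
  then have "\<bar>C * X - sqrt 3 * S * Sh\<bar> \<le> 2 * X" using X by (simp only: abs_le_square_iff[symmetric])
  then have E: "\<bar>1 + C * X - sqrt 3 * S * Sh\<bar> \<le> 1 + 2 * X" by linarith
  have "1 + 2 * X \<le> 39/100 * (X - 1)\<^sup>2"
  proof -
    have "0 \<le> (X - 37/5) * (39/100 * X)" using X by (intro mult_nonneg_nonneg) auto
    then have "39/100 * X\<^sup>2 \<ge> 2886/1000 * X" by (simp add: power2_eq_square algebra_simps)
    moreover have "(X - 1)\<^sup>2 = X\<^sup>2 - 2 * X + 1" by (simp add: power2_eq_square algebra_simps)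
    ultimately show ?thesis using X by linarith
  qed
  also have "\<dots> \<le> 39/100 * (C + X)\<^sup>2" using D by (intro mult_left_mono power_mono) auto
  finally have E': "\<bar>1 + C * X - sqrt 3 * S * Sh\<bar> / (C + X)\<^sup>2 \<le> 39/100"
    using E D by (simp add: divide_le_eq)
  \<comment> \<open>\<open>2 (1 + X) / (X - 1) \<le> 8/3\<close> as soon as \<open>X \<ge> 7\<close>\<close>
  have lin: "\<bar>2 * (y * S + z * Sh) / (C + X)\<bar> \<le> 8 / 3 * r" if "\<bar>y\<bar> \<le> r" "\<bar>z\<bar> \<le> r" for y z r
  proof -
    have r: "r \<ge> 0" using that by linarith
    have "\<bar>y * S + z * Sh\<bar> \<le> \<bar>y\<bar> * \<bar>S\<bar> + \<bar>z\<bar> * \<bar>Sh\<bar>" by (simp add: abs_mult[symmetric])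
    also have "\<dots> \<le> r * 1 + r * X" using that CS Sh ShX r by (intro add_mono mult_mono) auto
    also have "\<dots> = r * (1 + X)" by (simp add: algebra_simps)
    also have "\<dots> \<le> r * (4 / 3 * (X - 1))" using r X by (intro mult_left_mono) auto
    also have "\<dots> \<le> r * (4 / 3 * (C + X))" using r D by (intro mult_left_mono) auto
    finally have le: "\<bar>y * S + z * Sh\<bar> / (C + X) \<le> 4 / 3 * r" using D by (simp add: divide_le_eq mult_ac)
    have "\<bar>2 * (y * S + z * Sh) / (C + X)\<bar> = 2 * (\<bar>y * S + z * Sh\<bar> / (C + X))"
      unfolding abs_divide abs_mult using D by simp
    also have "\<dots> \<le> 2 * (4 / 3 * r)" using le by (rule mult_left_mono) simp
    finally show ?thesis by simp
  qed
  have F: "\<bar>2 * (u' * S + v' * Sh) / (C + X)\<bar> \<le> 3" using lin[of u' 1 v'] bnd by linarith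
  have GG: "\<bar>G\<bar> \<le> 4" using lin[of u "3/2" v] bnd unfolding G by linarith
  define Q where "Q = p\<^sup>2 + G\<^sup>2"
  have Q: "Q \<ge> 1/100" "p\<^sup>2 \<le> Q" using low by (auto simp: Q_def)
  define E0 F0 where "E0 = (1 + C * X - sqrt 3 * S * Sh) / (C + X)\<^sup>2"
    and "F0 = 2 * (u' * S + v' * Sh) / (C + X)"
  have E0: "\<bar>E0\<bar> \<le> 39/100" using E' by (simp add: E0_def abs_divide)
  have F0: "\<bar>F0\<bar> \<le> 3" using F by (simp only: F0_def)
  have "\<bar>F0 * p\<bar> \<le> 3 * 1" unfolding abs_mult using F0 p by (intro mult_mono) auto
  moreover have "\<bar>G * p'\<bar> \<le> 4 * 1" unfolding abs_mult using GG bnd by (intro mult_mono) auto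
  ultimately have "\<bar>F0 * p - G * p'\<bar> \<le> 7" by linarith
  also have "7 \<le> 700 * Q" using Q by simp
  finally have 1: "\<bar>F0 * p - G * p'\<bar> \<le> 700 * Q" .
  have "\<bar>N * p\<^sup>2 * E0\<bar> = \<bar>E0\<bar> * (N * p\<^sup>2)" using N by (simp add: abs_mult)
  also have "\<dots> \<le> 39/100 * (N * Q)" using E0 N Q by (intro mult_mono) auto
  finally have 2: "\<bar>N * p\<^sup>2 * E0\<bar> \<le> 39/100 * (N * Q)" .
  have "\<bar>(N * p * E0 + F0) * p - G * p'\<bar> = \<bar>N * p\<^sup>2 * E0 + (F0 * p - G * p')\<bar>"
    by (simp add: algebra_simps power2_eq_square)
  also have "\<dots> \<le> (39/100 * N + 700) * Q" using 1 2 abs_triangle_ineq[of "N * p\<^sup>2 * E0" "F0 * p - G * p'"]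
    by (simp add: algebra_simps)
  finally have "\<bar>((N * p * E0 + F0) * p - G * p') / Q\<bar> \<le> 39/100 * N + 700"
    using Q by (simp add: divide_le_eq)
  then show ?thesis by (simp only: E0_def F0_def Q_def times_divide_eq_right)
qed

text \<open>
  For large \<open>X\<close> the term \<open>v Sh / X\<close>, close to \<open>v\<close>, dominates the oscillating one.
\<close>

lemma resonance_lower_bound:
  fixes u v S C Sh X :: real
  assumes "\<bar>S\<bar> \<le> 1" "\<bar>C\<bar> \<le> 1" "X \<ge> 20" "Sh \<ge> X - 1" "0 \<le> u" "u \<le> 3/2" "v \<ge> 0.15"
  shows "2 * (u * S + v * Sh) / (C + X) \<ge> 1/10"
proof -
  have "u * S \<ge> - (3/2)"
  proof -
    have "\<bar>u * S\<bar> \<le> 3/2 * 1" unfolding abs_mult using assms by (intro mult_mono) auto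
    then show ?thesis by linarith
  qed
  moreover have "v * Sh \<ge> 0.15 * (X - 1)" using assms by (intro mult_mono) auto
  ultimately have "2 * (u * S + v * Sh) \<ge> 1/10 * (X + 1)" using assms by (simp add: algebra_simps)
  moreover have "1/10 * (C + X) \<le> 1/10 * (X + 1)" using assms by auto
  moreover have "C + X > 0" using assms by auto
  ultimately show ?thesis by (simp add: le_divide_eq)
qed

section \<open>The contraction bound\<close>

text \<open>The function \<open>G\<^sub>\<theta>\<close> of the introduction; adding \<open>\<pi>\<close> to the phase \<open>\<theta>\<close> flips the signs of
  sine and cosine, which is what distinguishes \<open>h\<close> from \<open>f\<close>.\<close>

definition resonance :: "real \<Rightarrow> real \<Rightarrow> real \<Rightarrow> real" where
  "resonance \<theta> N \<phi> =
     2 * (u_part \<phi> * sin (N * (2 * Re (half_branch \<phi>)) + \<theta>) + v_part \<phi> * sinh (N * (2 * Im (half_branch \<phi>))))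
       / (cos (N * (2 * Re (half_branch \<phi>)) + \<theta>) + cosh (N * (2 * Im (half_branch \<phi>))))"

lemma arsinh_real_mono:
  assumes "x \<le> (y::real)"
  shows "arsinh x \<le> arsinh y"
proof -
  have "sinh (arsinh x) \<le> sinh (arsinh y)" using assms by simp
  then show ?thesis by (simp only: sinh_real_le_iff)
qed

text \<open>
  The imaginary part of \<open>sin (\<beta>/2) = exp (\<i>\<pi>/3) sin (\<phi>/2)\<close> reads
  \<open>cos (c/2) sinh (b/2) = (\<surd>3/2) sin (\<phi>/2)\<close>, and \<open>0 < cos (c/2) \<le> 1\<close>.
\<close>

lemma Im_half_branch_ge:
  assumes "\<phi> \<in> {0..pi}"
  shows "Im (half_branch \<phi>) \<ge> arsinh (sqrt 3 / 2 * sin (\<phi> / 2))"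
proof -
  have "cos (Re (half_branch \<phi>)) * sinh (Im (half_branch \<phi>)) = Im (sin (half_branch \<phi>))"
    by (simp add: Im_sin sinh_def)
  also have "\<dots> = sqrt 3 / 2 * sin (\<phi> / 2)" unfolding sin_half_branch cis_pi_third by simp
  finally have eq: "cos (Re (half_branch \<phi>)) * sinh (Im (half_branch \<phi>)) = sqrt 3 / 2 * sin (\<phi> / 2)" .
  have "sin (\<phi> / 2) \<ge> 0" using assms by (intro sin_ge_zero) auto
  then have "0 \<le> cos (Re (half_branch \<phi>)) * sinh (Im (half_branch \<phi>))" unfolding eq by simp
  then have "0 \<le> sinh (Im (half_branch \<phi>))" using cos_Re_half_branch[of \<phi>] by (simp add: zero_le_mult_iff)
  then have "sinh (arsinh (sqrt 3 / 2 * sin (\<phi> / 2))) \<le> sinh (Im (half_branch \<phi>))"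
    unfolding sinh_arsinh_real eq[symmetric] by (intro mult_left_le_one_le) (auto intro: less_imp_le cos_Re_half_branch)
  then show ?thesis by (simp only: sinh_real_le_iff)
qed

lemma cosh_2_7_ge: "cosh (2.7::real) \<ge> 37/5"
proof -
  have "(1.105::real) \<le> exp 0.1" using exp_lower_Taylor_quadratic[of "0.1::real"] by (simp add: power2_eq_square)
  then have "(1.105::real) ^ 27 \<le> exp 0.1 ^ 27" by (intro power_mono) auto
  also have "exp (0.1::real) ^ 27 = exp 2.7" by (simp flip: exp_of_nat_mult)
  finally have "exp (2.7::real) \<ge> 14.8" by (simp add: power_divide)
  moreover have "exp (- 2.7::real) > 0" by simp
  ultimately have "exp 2.7 + exp (- 2.7::real) \<ge> 14.8" by linarith
  then show ?thesis by (simp add: cosh_def)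
qed

lemma uv_bounds: "\<bar>u_part \<phi>\<bar> \<le> 3/2" "\<bar>v_part \<phi>\<bar> \<le> 3/2"
proof -
  have "sqrt 2 \<le> (3/2::real)" by (rule real_le_lsqrt) (auto simp: power2_eq_square)
  then show "\<bar>u_part \<phi>\<bar> \<le> 3/2" "\<bar>v_part \<phi>\<bar> \<le> 3/2"
    using norm_cos_half_branch_le[of \<phi>] abs_Re_le_cmod[of "cos (half_branch \<phi>)"]
      abs_Im_le_cmod[of "cos (half_branch \<phi>)"] unfolding u_part_def v_part_def by auto
qed

text \<open>
  \<open>u \<le> \<surd>2\<close> turns the equation for \<open>u v\<close> into a lower bound for \<open>v\<close>.
\<close>

lemma v_part_ge:
  assumes "(sin (\<phi> / 2))\<^sup>2 \<ge> 1/2"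
  shows "v_part \<phi> \<ge> 0.15"
proof (rule ccontr)
  assume "\<not> ?thesis"
  then have v: "v_part \<phi> < 0.15" by simp
  have s: "sqrt 3 \<ge> (1.7::real)" by (rule real_le_rsqrt) (simp add: power2_eq_square)
  have "2 * u_part \<phi> * v_part \<phi> \<ge> 1.7 / 2 * (1 / 2)"
    unfolding uv_Im using assms s by (intro mult_mono) auto
  moreover have "u_part \<phi> * v_part \<phi> \<le> sqrt 2 * 0.15"
    using v v_part_nonneg[of \<phi>] u_part_pos[of \<phi>] norm_cos_half_branch_le[of \<phi>]
      complex_Re_le_cmod[of "cos (half_branch \<phi>)"]
    by (intro mult_mono) (auto simp: u_part_def)
  moreover have "sqrt 2 < (1.4166::real)" by (rule real_less_lsqrt) (auto simp: power2_eq_square)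
  ultimately show False by simp
qed

text \<open>
  The two lower bounds on \<open>cosh (N b)\<close> serve different ends: the first makes the leading term small;
  the second keeps \<open>p\<^sup>2 + G\<^sup>2\<close> away from \<open>0\<close>, which takes an argument only where \<open>p\<^sup>2 \<le> 1/2\<close>.
\<close>

lemma arctan_resonance_deriv:
  assumes \<phi>: "\<phi> \<in> {0<..<pi}" and N: "N > 0"
    and cosh1: "cosh (N * (2 * Im (half_branch \<phi>))) \<ge> 37/5"
    and cosh2: "(sin (\<phi> / 2))\<^sup>2 \<ge> 1/2 \<Longrightarrow> cosh (N * (2 * Im (half_branch \<phi>))) \<ge> 20"
  shows "\<exists>d. ((\<lambda>x. arctan (resonance \<theta> N x / cos (x / 2))) has_real_derivative d) (at \<phi>) \<and> \<bar>d\<bar> \<le> 39/100 * N + 700"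
proof -
  define p p' where "p = cos (\<phi> / 2)" and "p' = - sin (\<phi> / 2) / 2"
  have p: "p > 0" "p \<le> 1" using \<phi> unfolding p_def by (auto intro: cos_gt_zero_pi)
  define \<eta> where "\<eta> = cis (pi / 3) * of_real p / (2 * cos (half_branch \<phi>))"
  define wd where "wd = - (cis (2 * pi / 3) * of_real (sin (\<phi> / 2) * cos (\<phi> / 2)) / (2 * cos (half_branch \<phi>)))"
  note d\<eta> = has_real_derivative_Re_Im[OF half_branch_deriv[of \<phi>], folded p_def, folded \<eta>_def]
  note wd = has_real_derivative_Re_Im[OF cos_half_branch_deriv[of \<phi>], folded wd_def]
  define c b c' b' u' v' where "c x = 2 * Re (half_branch x)" and "b x = 2 * Im (half_branch x)"
    and "c' = 2 * Re \<eta>" and "b' = 2 * Im \<eta>" and "u' = Re wd" and "v' = - Im wd" for x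
  have du: "(u_part has_real_derivative u') (at \<phi>)"
    unfolding u_part_def[abs_def] u'_def by (rule wd)
  have dv: "(v_part has_real_derivative v') (at \<phi>)"
    unfolding v_part_def[abs_def] v'_def by (rule DERIV_minus[OF wd(2)])
  have dc: "(c has_real_derivative c') (at \<phi>)"
    unfolding c_def[abs_def] c'_def by (rule DERIV_cmult[OF d\<eta>(1)])
  have db: "(b has_real_derivative b') (at \<phi>)"
    unfolding b_def[abs_def] b'_def by (rule DERIV_cmult[OF d\<eta>(2)])
  have "Complex (u_part \<phi>) (- v_part \<phi>) * Complex c' b' = cos (half_branch \<phi>) * (2 * \<eta>)"
    unfolding cos_half_branch_eq by (simp add: c'_def b'_def complex_eq_iff)
  also have "\<dots> = Complex (1 / 2) (sqrt 3 / 2) * of_real p"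
    using cos_half_branch_nz[of \<phi>] by (simp add: \<eta>_def cis_pi_third)
  finally have CR: "Complex (u_part \<phi>) (- v_part \<phi>) * Complex c' b' = Complex (1 / 2) (sqrt 3 / 2) * of_real p" .
  from arg_cong[OF CR, of Re] arg_cong[OF CR, of Im]
  have cr: "u_part \<phi> * c' + v_part \<phi> * b' = p / 2" "u_part \<phi> * b' - v_part \<phi> * c' = sqrt 3 / 2 * p"
    by (simp_all add: mult_ac)
  define S C Sh X where "S = sin (N * c \<phi> + \<theta>)" and "C = cos (N * c \<phi> + \<theta>)"
    and "Sh = sinh (N * b \<phi>)" and "X = cosh (N * b \<phi>)"
  have pyth: "S\<^sup>2 = 1 - C\<^sup>2" "Sh\<^sup>2 = X\<^sup>2 - 1"
    by (simp_all add: S_def C_def Sh_def X_def sin_squared_eq sinh_square_eq)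
  have X: "X \<ge> 37/5" "(sin (\<phi> / 2))\<^sup>2 \<ge> 1/2 \<Longrightarrow> X \<ge> 20" using cosh1 cosh2 by (auto simp: X_def b_def)
  have CS: "\<bar>C\<bar> \<le> 1" "\<bar>S\<bar> \<le> 1" by (auto simp: C_def S_def)
  then have D: "C + X \<noteq> 0" using X by linarith
  have b0: "b \<phi> \<ge> 0"
  proof -
    have "sin (\<phi> / 2) \<ge> 0" using \<phi> by (intro sin_ge_zero) auto
    then have "0 \<le> sqrt 3 / 2 * sin (\<phi> / 2)" by simp
    then have "arsinh 0 \<le> arsinh (sqrt 3 / 2 * sin (\<phi> / 2))" by (rule arsinh_real_mono)
    then show ?thesis using Im_half_branch_ge[of \<phi>] \<phi> by (simp add: b_def)
  qed
  then have Sh: "Sh \<ge> 0" using N by (simp add: Sh_def)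
  have ShX: "Sh \<ge> X - 1"
    by (rule power2_le_imp_le) (use pyth X Sh in \<open>auto simp: power2_eq_square algebra_simps\<close>)
  define G where "G = 2 * (u_part \<phi> * S + v_part \<phi> * Sh) / (C + X)"
  have G: "G = resonance \<theta> N \<phi>"
    by (simp add: G_def resonance_def S_def C_def Sh_def X_def c_def b_def)
  define Gd where "Gd = N * p * (1 + C * X - sqrt 3 * S * Sh) / (C + X)\<^sup>2 + 2 * (u' * S + v' * Sh) / (C + X)"
  have dG: "(resonance \<theta> N has_real_derivative Gd) (at \<phi>)"
    using trig_quotient_deriv[OF du dv dc db cr, of N \<theta>] D
    unfolding Gd_def S_def C_def Sh_def X_def resonance_def[abs_def] c_def b_def by blast
  have dp: "((\<lambda>x. cos (x / 2)) has_real_derivative p') (at \<phi>)"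
    unfolding p'_def by (auto intro!: derivative_eq_intros)
  have low: "p\<^sup>2 + G\<^sup>2 \<ge> 1/100"
  proof (cases "(sin (\<phi> / 2))\<^sup>2 \<ge> 1/2")
    case True
    have "G \<ge> 1/10" unfolding G_def
      by (rule resonance_lower_bound) (use CS X(2)[OF True] ShX v_part_ge[OF True] uv_bounds[of \<phi>] u_part_pos[of \<phi>] in auto)
    then have "G\<^sup>2 \<ge> (1/10)\<^sup>2" by (intro power_mono) auto
    also have "(1/10)\<^sup>2 = (1/100 :: real)" by (simp add: power2_eq_square)
    finally show ?thesis using zero_le_power2[of p] by linarith
  next
    case False
    have "p\<^sup>2 = 1 - (sin (\<phi> / 2))\<^sup>2" by (simp add: p_def cos_squared_eq)
    then show ?thesis using False zero_le_power2[of G] by linarith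
  qed
  have "cmod wd \<le> 1"
  proof -
    have "\<bar>sin (\<phi> / 2)\<bar> * \<bar>cos (\<phi> / 2)\<bar> \<le> 1 * 1" by (intro mult_mono) auto
    then have "\<bar>sin (\<phi> / 2)\<bar> * \<bar>cos (\<phi> / 2)\<bar> \<le> 2 * cmod (cos (half_branch \<phi>))"
      using norm_cos_half_branch_ge[of \<phi>] by linarith
    then show ?thesis using cos_half_branch_nz[of \<phi>]
      unfolding wd_def norm_minus_cancel norm_divide norm_mult by (simp add: divide_le_eq abs_mult norm_mult)
  qed
  then have wd1: "\<bar>u'\<bar> \<le> 1" "\<bar>v'\<bar> \<le> 1"
    using abs_Re_le_cmod[of wd] abs_Im_le_cmod[of wd] unfolding u'_def v'_def by auto
  have p'1: "\<bar>p'\<bar> \<le> 1" using abs_sin_le_one[of "\<phi> / 2"] unfolding p'_def by linarith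
  have bound: "\<bar>(Gd * p - G * p') / (p\<^sup>2 + G\<^sup>2)\<bar> \<le> 39/100 * N + 700"
    unfolding Gd_def
    by (rule resonance_deriv_bound[OF pyth Sh X(1) _ _ p(2) uv_bounds wd1 p'1 G_def low]) (use N p in auto)
  have "((\<lambda>x. resonance \<theta> N x / cos (x / 2)) has_real_derivative (Gd * p - G * p') / (p * p)) (at \<phi>)"
    unfolding G p_def by (rule DERIV_divide[OF dG dp]) (use p in \<open>simp add: p_def\<close>)
  then have "((\<lambda>x. arctan (resonance \<theta> N x / cos (x / 2))) has_real_derivative
      inverse (1 + (G / p)\<^sup>2) * ((Gd * p - G * p') / (p * p))) (at \<phi>)"
    unfolding G p_def by (rule DERIV_chain2[OF DERIV_arctan])
  \<comment> \<open>The factor \<open>p\<^sup>2\<close> cancels, so the bound does not deteriorate as \<open>p \<rightarrow> 0\<close> at \<open>\<phi> = \<pi>\<close>.\<close>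
  moreover have "inverse (1 + (G / p)\<^sup>2) * ((Gd * p - G * p') / (p * p)) = (Gd * p - G * p') / (p\<^sup>2 + G\<^sup>2)"
  proof -
    have Q: "p\<^sup>2 + G\<^sup>2 \<noteq> 0" using low by linarith
    have "inverse (1 + (G / p)\<^sup>2) = p\<^sup>2 / (p\<^sup>2 + G\<^sup>2)" using p Q by (simp add: field_simps)
    then show ?thesis using p by (simp add: power2_eq_square)
  qed
  ultimately show ?thesis using bound by auto
qed

text \<open>
  At the left end \<open>\<phi> = \<pi>/N\<close> the bound of \<open>Im_half_branch_ge\<close> for \<open>N b\<close> converges to
  \<open>\<pi>\<surd>3/2 = 2.72...\<close>, and it only grows with \<open>\<phi>\<close>. Where \<open>sin\<^sup>2 (\<phi>/2) \<ge> 1/2\<close>, \<open>b\<close> is bounded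
  below by a positive constant, so \<open>N b\<close> tends to infinity uniformly.
\<close>

lemma eventually_arctan_resonance_deriv:
  "eventually (\<lambda>N::real. \<forall>\<phi>\<in>{pi / N..pi - pi / N}. \<forall>\<theta>.
     \<exists>d. ((\<lambda>x. arctan (resonance \<theta> N x / cos (x / 2))) has_real_derivative d) (at \<phi>) \<and> \<bar>d\<bar> \<le> 0.4 * N) at_top"
proof -
  define \<delta> :: real where "\<delta> = arsinh (sqrt 3 / 2 * sqrt (1 / 2))"
  have "sinh \<delta> > 0" unfolding \<delta>_def sinh_arsinh_real by simp
  then have \<delta>: "\<delta> > 0" by simp
  have "((\<lambda>N::real. N * (2 * arsinh (sqrt 3 / 2 * sin (pi / N / 2)))) \<longlongrightarrow> pi * sqrt 3 / 2) at_top"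
    unfolding arsinh_real_def sqrt_def by real_asymp
  moreover have "pi * sqrt 3 / 2 > 2.7"
  proof -
    have "sqrt 3 \<ge> (1.73::real)" by (rule real_le_rsqrt) (simp add: power2_eq_square)
    then have "3.14 * 1.73 \<le> pi * sqrt 3" using pi_approx by (intro mult_mono) auto
    then show ?thesis by simp
  qed
  ultimately have "eventually (\<lambda>N::real. N * (2 * arsinh (sqrt 3 / 2 * sin (pi / N / 2))) > 2.7) at_top"
    by (rule order_tendstoD)
  moreover have "eventually (\<lambda>N::real. N \<ge> 20 / \<delta>) at_top" by (rule eventually_ge_at_top)
  \<comment> \<open>\<open>700 \<le> 0.01 N\<close> from here on, so that \<open>0.39 N + 700 \<le> 0.4 N\<close>\<close>
  moreover have "eventually (\<lambda>N::real. N \<ge> 70000) at_top" by (rule eventually_ge_at_top)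
  ultimately show ?thesis
  proof eventually_elim
    case (elim N)
    then have N: "N > 0" by simp
    show ?case
    proof (intro ballI allI)
      fix \<phi> \<theta> assume "\<phi> \<in> {pi / N..pi - pi / N}"
      then have 1: "pi / N \<le> \<phi>" "\<phi> \<le> pi - pi / N" by auto
      have "pi / N > 0" using N by simp
      then have \<phi>: "\<phi> \<in> {0<..<pi}" using 1 by auto
      have cosh_ge: "cosh (N * (2 * Im (half_branch \<phi>))) \<ge> cosh y" if "s \<le> sin (\<phi> / 2)" "0 \<le> y" "y \<le> N * (2 * arsinh (sqrt 3 / 2 * s))" for s y
      proof -
        have "arsinh (sqrt 3 / 2 * s) \<le> arsinh (sqrt 3 / 2 * sin (\<phi> / 2))"
          using that by (intro arsinh_real_mono mult_left_mono) auto
        also have "\<dots> \<le> Im (half_branch \<phi>)" using \<phi> by (intro Im_half_branch_ge) auto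
        finally have "N * (2 * arsinh (sqrt 3 / 2 * s)) \<le> N * (2 * Im (half_branch \<phi>))"
          using N by (intro mult_left_mono) auto
        then show ?thesis using that by (subst cosh_real_nonneg_le_iff) auto
      qed
      have "\<exists>d. ((\<lambda>x. arctan (resonance \<theta> N x / cos (x / 2))) has_real_derivative d) (at \<phi>) \<and> \<bar>d\<bar> \<le> 39/100 * N + 700"
      proof (rule arctan_resonance_deriv[OF \<phi> N])
        have "sin (pi / N / 2) \<le> sin (\<phi> / 2)"
          by (rule sin_monotone_2pi_le) (use 1 N \<phi> in \<open>auto intro: order_trans[of _ 0]\<close>)
        then have "cosh (N * (2 * Im (half_branch \<phi>))) \<ge> cosh 2.7"
          using elim by (intro cosh_ge[of "sin (pi / N / 2)"]) auto
        then show "cosh (N * (2 * Im (half_branch \<phi>))) \<ge> 37/5" using cosh_2_7_ge by linarith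
      next
        assume "1/2 \<le> (sin (\<phi> / 2))\<^sup>2"
        moreover have "sin (\<phi> / 2) \<ge> 0" using \<phi> by (intro sin_ge_zero) auto
        ultimately have "sqrt (1/2) \<le> sin (\<phi> / 2)" by (intro real_le_lsqrt) auto
        moreover have "40 \<le> N * (2 * \<delta>)" using elim \<delta> by (simp add: divide_le_eq)
        ultimately have "cosh (N * (2 * Im (half_branch \<phi>))) \<ge> cosh 40"
          by (intro cosh_ge[of "sqrt (1/2)"]) (auto simp: \<delta>_def)
        moreover have "cosh (40::real) \<ge> 20"
        proof -
          have "exp 40 + exp (- 40 :: real) \<ge> 40"
            using exp_ge_add_one_self[of "40::real"] exp_gt_zero[of "-40::real"] by linarith
          then show ?thesis by (simp add: cosh_def)
        qed
        ultimately show "20 \<le> cosh (N * (2 * Im (half_branch \<phi>)))" by linarith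
      qed
      then show "\<exists>d. ((\<lambda>x. arctan (resonance \<theta> N x / cos (x / 2))) has_real_derivative d) (at \<phi>) \<and> \<bar>d\<bar> \<le> 0.4 * N"
        using elim by force
    qed
  qed
qed

section \<open>The fixed-point iteration\<close>

text \<open>
  The closed interval \<open>I\<close> is complete, as Banach's theorem requires; as \<open>arctan\<close> takes values
  strictly between \<open>-\<pi>/2\<close> and \<open>\<pi>/2\<close>, fixed points and iterates lie in its interior. There
  \<open>N \<phi> / 2 - a\<close> is in the range of \<open>arctan\<close>, so the fixed points are the roots of the tangent
  equation. The recursion is assumed for iterates in the interior only, since outside
  \<open>(0, \<pi>)\<close> the function \<open>F\<close> need not agree with \<open>f\<close> or \<open>- h\<close>.
\<close>

lemma arctan_iteration:
  fixes F :: "real \<Rightarrow> real" and N a :: real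
  defines "I \<equiv> {2 / N * (a - pi / 2)..2 / N * (a + pi / 2)}"
  assumes N: "N > 0"
    and deriv: "\<And>\<phi>. \<phi> \<in> I \<Longrightarrow> \<exists>d. ((\<lambda>x. arctan (F x)) has_real_derivative d) (at \<phi>) \<and> \<bar>d\<bar> \<le> 0.4 * N"
  shows "\<exists>!\<phi>. \<phi> \<in> {2 / N * (a - pi / 2)<..<2 / N * (a + pi / 2)} \<and> tan (N / 2 * \<phi> - a) = F \<phi>" (is ?root)
    and "\<lbrakk>x 0 = 2 / N * a; \<And>k. x k \<in> interior I \<Longrightarrow> x (Suc k) = 2 / N * (a + arctan (F (x k)))\<rbrakk>
         \<Longrightarrow> \<bar>x (Suc k) - x k\<bar> \<le> pi / N * 0.8 ^ k \<and> x k \<in> interior I"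
proof -
  define g where "g \<phi> = 2 / N * (a + arctan (F \<phi>))" for \<phi>
  have intI: "interior I = {2 / N * (a - pi / 2)<..<2 / N * (a + pi / 2)}" by (simp add: I_def)
  have g_in: "g \<phi> \<in> interior I" for \<phi>
    unfolding intI g_def greaterThanLessThan_iff using N arctan_bounded[of "F \<phi>"]
    by (intro conjI mult_strict_left_mono) auto
  have lip: "\<bar>g \<phi> - g \<psi>\<bar> \<le> 0.8 * \<bar>\<phi> - \<psi>\<bar>" if "\<phi> \<in> I" "\<psi> \<in> I" for \<phi> \<psi>
  proof -
    obtain d where d: "\<And>z. z \<in> I \<Longrightarrow> ((\<lambda>x. arctan (F x)) has_real_derivative d z) (at z)"
        "\<And>z. z \<in> I \<Longrightarrow> \<bar>d z\<bar> \<le> 0.4 * N"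
      using deriv by metis
    have "norm (arctan (F \<phi>) - arctan (F \<psi>)) \<le> 0.4 * N * norm (\<phi> - \<psi>)"
      by (rule field_differentiable_bound[of I _ d])
         (use d that in \<open>auto simp: I_def intro: has_field_derivative_at_within\<close>)
    then have "2 / N * \<bar>arctan (F \<phi>) - arctan (F \<psi>)\<bar> \<le> 2 / N * (0.4 * N * \<bar>\<phi> - \<psi>\<bar>)"
      using N by (intro mult_left_mono) auto
    moreover have "\<bar>g \<phi> - g \<psi>\<bar> = 2 / N * \<bar>arctan (F \<phi>) - arctan (F \<psi>)\<bar>"
    proof -
      have "g \<phi> - g \<psi> = 2 / N * (arctan (F \<phi>) - arctan (F \<psi>))"
        by (simp add: g_def algebra_simps add_divide_distrib diff_divide_distrib)
      also have "\<bar>\<dots>\<bar> = 2 / N * \<bar>arctan (F \<phi>) - arctan (F \<psi>)\<bar>"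
        unfolding abs_mult using N by simp
      finally show ?thesis .
    qed
    ultimately show ?thesis using N by simp
  qed
  have "\<exists>!\<phi>\<in>I. g \<phi> = \<phi>"
  proof (rule Banach_fix[of _ "0.8"])
    show "complete I" by (simp add: I_def complete_eq_closed)
    show "I \<noteq> {}" using g_in interior_subset by fastforce
    show "g ` I \<subseteq> I" using g_in interior_subset by fastforce
  qed (use lip in \<open>auto simp: dist_real_def\<close>)
  moreover have "(\<phi> \<in> I \<and> g \<phi> = \<phi>) \<longleftrightarrow> (\<phi> \<in> interior I \<and> tan (N / 2 * \<phi> - a) = F \<phi>)" for \<phi>
  proof
    assume *: "\<phi> \<in> I \<and> g \<phi> = \<phi>"
    have "N / 2 * \<phi> - a = N / 2 * g \<phi> - a" using * by simp
    also have "\<dots> = arctan (F \<phi>)" using N by (simp add: g_def field_simps)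
    finally show "\<phi> \<in> interior I \<and> tan (N / 2 * \<phi> - a) = F \<phi>" using g_in[of \<phi>] * by (simp add: tan_arctan)
  next
    assume *: "\<phi> \<in> interior I \<and> tan (N / 2 * \<phi> - a) = F \<phi>"
    then have "- (pi / 2) < N / 2 * \<phi> - a" "N / 2 * \<phi> - a < pi / 2"
      using N unfolding intI by (auto simp: field_simps)
    then have "arctan (F \<phi>) = N / 2 * \<phi> - a" using * by (intro arctan_unique) auto
    then have "g \<phi> = \<phi>" using N by (simp add: g_def)
    then show "\<phi> \<in> I \<and> g \<phi> = \<phi>" using * interior_subset by blast
  qed
  ultimately show ?root unfolding intI[symmetric] by auto
  show "\<bar>x (Suc k) - x k\<bar> \<le> pi / N * 0.8 ^ k \<and> x k \<in> interior I"
    if init: "x 0 = 2 / N * a" and step: "\<And>k. x k \<in> interior I \<Longrightarrow> x (Suc k) = 2 / N * (a + arctan (F (x k)))"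
  proof (induction k)
    case 0
    have x0: "x 0 \<in> interior I"
      unfolding intI init greaterThanLessThan_iff using N by (intro conjI mult_strict_left_mono) auto
    have "\<bar>arctan (F (x 0))\<bar> \<le> pi / 2" using arctan_bounded[of "F (x 0)"] by linarith
    then have "2 / N * \<bar>arctan (F (x 0))\<bar> \<le> 2 / N * (pi / 2)" using N by (intro mult_left_mono) auto
    moreover have "x (Suc 0) - x 0 = 2 / N * arctan (F (x 0))"
      unfolding step[OF x0] by (simp add: init distrib_left)
    ultimately have "\<bar>x (Suc 0) - x 0\<bar> \<le> pi / N * 0.8 ^ 0"
      using N by (simp add: abs_mult)
    with x0 show ?case by simp
  next
    case (Suc k)
    then have gk: "x (Suc k) = g (x k)" unfolding g_def by (intro step) simp
    then have in': "x (Suc k) \<in> interior I" using g_in[of "x k"] by simp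
    then have gk': "x (Suc (Suc k)) = g (x (Suc k))" unfolding g_def by (intro step)
    have "\<bar>x (Suc (Suc k)) - x (Suc k)\<bar> = \<bar>g (x (Suc k)) - g (x k)\<bar>"
      unfolding gk' unfolding gk ..
    also have "\<dots> \<le> 0.8 * \<bar>x (Suc k) - x k\<bar>"
      using in' Suc.IH interior_subset[of I] by (intro lip) auto
    also have "\<dots> \<le> 0.8 * (pi / N * 0.8 ^ k)" using Suc.IH by (intro mult_left_mono) auto
    finally show ?case using in' by simp
  qed
qed

section \<open>The two equations\<close>

lemma f_h_eq_resonance:
  assumes "regular_branch \<beta>" "\<phi> \<in> {0<..<pi}"
  shows "f_fun \<beta> n \<phi> = resonance 0 (real (n + 3)) \<phi> / cos (\<phi> / 2)"
    and "h_fun \<beta> n \<phi> = - (resonance pi (real (n + 3)) \<phi> / cos (\<phi> / 2))"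
proof -
  define s p where "s = sin (\<phi> / 2)" and "p = cos (\<phi> / 2)"
  have s: "s > 0" unfolding s_def using assms by (intro sin_gt_zero) auto
  have p: "p > 0" unfolding p_def using assms by (intro cos_gt_zero_pi) auto
  have \<beta>: "\<beta> \<phi> = 2 * half_branch \<phi>" using assms by (intro regular_branch_eq_half_branch) auto
  have "sin (\<beta> \<phi>) * cis (- pi / 3) = 2 * of_real s * cos (half_branch \<phi>) * (cis (pi / 3) * cis (- pi / 3))"
    unfolding \<beta> sin_double sin_half_branch s_def by (simp only: mult_ac)
  also have "cis (pi / 3) * cis (- pi / 3) = 1" by (simp add: cis_mult)
  finally have BC: "B_part \<beta> \<phi> = 2 * s * u_part \<phi>" "C_part \<beta> \<phi> = 2 * s * v_part \<phi>"
    by (simp_all add: B_part_def C_part_def cos_half_branch_eq)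
  have RI: "Re (2 * z) = 2 * Re z" "Im (2 * z) = 2 * Im z" for z by simp_all
  have sin: "sin \<phi> = 2 * s * p" using sin_double[of "\<phi> / 2"] by (simp add: s_def p_def)
  have cancel: "2 * ((2 * s * u * S + 2 * s * v * Sh) / (2 * s * p * D)) = 2 * (u * S + v * Sh) / D / p" for u S v Sh D
    using s p by (cases "D = 0") (simp_all add: field_simps)
  show "f_fun \<beta> n \<phi> = resonance 0 (real (n + 3)) \<phi> / cos (\<phi> / 2)"
    unfolding f_fun_def resonance_def BC sin c_part_def b_part_def \<beta> p_def[symmetric]
    by (simp only: RI cancel add_0_right)
  have neg: "2 * ((2 * s * u * S - 2 * s * v * Sh) / (2 * s * p * (- C + D))) = - (2 * (u * - S + v * Sh) / (- C + D) / p)" for u S v Sh C D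
    using s p by (cases "- C + D = 0") (simp_all add: field_simps)
  show "h_fun \<beta> n \<phi> = - (resonance pi (real (n + 3)) \<phi> / cos (\<phi> / 2))"
    unfolding h_fun_def resonance_def BC sin c_part_def b_part_def \<beta> p_def[symmetric] sin_periodic_pi cos_periodic_pi
    by (simp only: RI neg)
qed

theorem theorem2p2:
  fixes \<beta> :: "real \<Rightarrow> complex"
  assumes "regular_branch \<beta>"
  shows "\<exists>(n\<^sub>0::nat) (L::real). \<forall>n\<ge>n\<^sub>0.
    (\<forall>j\<in>{1..(n + 1) div 2}.
       (\<exists>!\<phi>. \<phi> \<in> {pi * (2 * real j - 1) / real (n + 3)<..<pi * (2 * real j + 1) / real (n + 3)} \<and>
             tan (real (n + 3) / 2 * \<phi>) = f_fun \<beta> n \<phi>) \<and>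
       (\<forall>k. \<bar>odd_iter \<beta> n j (Suc k) - odd_iter \<beta> n j k\<bar> \<le> L / real (n + 3) * 0.8 ^ k)) \<and>
    (\<forall>j\<in>{1..n div 2}.
       (\<exists>!\<phi>. \<phi> \<in> {2 * pi * real j / real (n + 3)<..<2 * pi * (real j + 1) / real (n + 3)} \<and>
             even_equation \<beta> n \<phi>) \<and>
       (\<forall>k. \<bar>even_iter \<beta> n j (Suc k) - even_iter \<beta> n j k\<bar> \<le> L / real (n + 3) * 0.8 ^ k))"
proof -
  have "eventually (\<lambda>n. \<forall>\<phi>\<in>{pi / real (n + 3)..pi - pi / real (n + 3)}. \<forall>\<theta>.
      \<exists>d. ((\<lambda>x. arctan (resonance \<theta> (real (n + 3)) x / cos (x / 2))) has_real_derivative d) (at \<phi>)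
        \<and> \<bar>d\<bar> \<le> 0.4 * real (n + 3)) sequentially"
    by (rule eventually_compose_filterlim[OF eventually_arctan_resonance_deriv]) real_asymp
  then obtain n\<^sub>0 where n\<^sub>0: "\<And>n \<phi> \<theta>. n \<ge> n\<^sub>0 \<Longrightarrow> \<phi> \<in> {pi / real (n + 3)..pi - pi / real (n + 3)} \<Longrightarrow>
      \<exists>d. ((\<lambda>x. arctan (resonance \<theta> (real (n + 3)) x / cos (x / 2))) has_real_derivative d) (at \<phi>)
        \<and> \<bar>d\<bar> \<le> 0.4 * real (n + 3)"
    unfolding eventually_sequentially by blast
  \<comment> \<open>The bounds on \<open>a\<close> hold for every admissible \<open>j\<close>: the extreme indices give intervals
    that reach \<open>\<pi>/N\<close> and \<open>\<pi> - \<pi>/N\<close>.\<close>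
  have interval: "{2 / N * (a - pi / 2)..2 / N * (a + pi / 2)} \<subseteq> {pi / N..pi - pi / N}"
    if "N > 0" "a \<ge> pi" "a \<le> pi / 2 * (N - 2)" for N a :: real
  proof -
    have "2 / N * (a - pi / 2) \<ge> 2 / N * (pi / 2)"
      by (rule mult_left_mono) (use that in auto)
    moreover have "2 / N * (a + pi / 2) \<le> 2 / N * (pi / 2 * (N - 1))"
      by (rule mult_left_mono) (use that in \<open>auto simp: algebra_simps\<close>)
    moreover have "2 / N * (pi / 2 * (N - 1)) = pi - pi / N" using that by (simp add: field_simps)
    ultimately show ?thesis by auto
  qed
  show ?thesis
  proof (intro exI[of _ n\<^sub>0] exI[of _ pi] allI impI, rule conjI; rule ballI)
    fix n j assume n: "n \<ge> n\<^sub>0" and j: "j \<in> {1..(n + 1) div 2}"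
    define N where "N = real (n + 3)"
    define F where "F \<phi> = resonance 0 N \<phi> / cos (\<phi> / 2)" for \<phi>
    define a where "a = pi * real j"
    have N: "N > 0" by (simp add: N_def)
    have "2 * j \<le> n + 1" using j by simp linarith
    then have "real (2 * j) \<le> real (n + 1)" by (simp only: of_nat_le_iff)
    then have "2 * real j \<le> N - 2" by (simp add: N_def)
    then have "pi / 2 * (2 * real j) \<le> pi / 2 * (N - 2)" by (intro mult_left_mono) auto
    then have a: "a \<ge> pi" "a \<le> pi / 2 * (N - 2)" using j by (simp_all add: a_def)
    note I = interval[OF N a]
    have "pi / N > 0" using N by simp
    then have I': "{2 / N * (a - pi / 2)<..<2 / N * (a + pi / 2)} \<subseteq> {0<..<pi}"
      using I by fastforce
    have f: "f_fun \<beta> n \<phi> = F \<phi>" if "\<phi> \<in> {2 / N * (a - pi / 2)<..<2 / N * (a + pi / 2)}" for \<phi>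
      using f_h_eq_resonance(1)[OF assms subsetD[OF I' that]] by (simp add: F_def N_def)
    note iter = arctan_iteration[of N a F, OF N n\<^sub>0[OF n, folded N_def, of _ 0, folded F_def, OF subsetD[OF I]]]
    have ends: "2 / N * (a - pi / 2) = pi * (2 * real j - 1) / N" "2 / N * (a + pi / 2) = pi * (2 * real j + 1) / N"
      using N by (simp_all add: a_def field_simps)
    have shift: "tan (N / 2 * \<phi> - a) = tan (N / 2 * \<phi>)" for \<phi>
      using tan_periodic_nat[of "N / 2 * \<phi> - a" j] by (simp add: a_def mult_ac)
    have root: "\<exists>!\<phi>. \<phi> \<in> {2 / N * (a - pi / 2)<..<2 / N * (a + pi / 2)} \<and> tan (N / 2 * \<phi>) = f_fun \<beta> n \<phi>"
      using iter(1) unfolding shift by (simp add: f cong: conj_cong)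
    have "odd_iter \<beta> n j 0 = 2 / N * a"
      using j by (simp add: d_node_def a_def N_def of_nat_diff field_simps)
    moreover have "odd_iter \<beta> n j (Suc k) = 2 / N * (a + arctan (F (odd_iter \<beta> n j k)))"
      if "odd_iter \<beta> n j k \<in> interior {2 / N * (a - pi / 2)..2 / N * (a + pi / 2)}" for k
      using f[OF that[unfolded interior_atLeastAtMost_real]]
      by (simp only: odd_iter.simps a_def N_def)
    ultimately have "\<bar>odd_iter \<beta> n j (Suc k) - odd_iter \<beta> n j k\<bar> \<le> pi / N * 0.8 ^ k" for k
      using iter(2)[of "odd_iter \<beta> n j" k] by blast
    with root show "(\<exists>!\<phi>. \<phi> \<in> {pi * (2 * real j - 1) / real (n + 3)<..<pi * (2 * real j + 1) / real (n + 3)} \<and>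
             tan (real (n + 3) / 2 * \<phi>) = f_fun \<beta> n \<phi>) \<and>
       (\<forall>k. \<bar>odd_iter \<beta> n j (Suc k) - odd_iter \<beta> n j k\<bar> \<le> pi / real (n + 3) * 0.8 ^ k)"
      unfolding ends unfolding N_def by blast
  next
    fix n j assume n: "n \<ge> n\<^sub>0" and j: "j \<in> {1..n div 2}"
    define N where "N = real (n + 3)"
    define F where "F \<phi> = resonance pi N \<phi> / cos (\<phi> / 2)" for \<phi>
    define a where "a = pi * real j + pi / 2"
    have N: "N > 0" by (simp add: N_def)
    have "2 * j \<le> n" using j by simp linarith
    then have "real (2 * j) \<le> real n" by (simp only: of_nat_le_iff)
    then have "2 * real j + 1 \<le> N - 2" by (simp add: N_def)
    then have "pi / 2 * (2 * real j + 1) \<le> pi / 2 * (N - 2)" by (intro mult_left_mono) auto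
    then have a2: "a \<le> pi / 2 * (N - 2)" by (simp add: a_def algebra_simps)
    have "pi * 1 \<le> pi * real j" using j by (intro mult_left_mono) auto
    then have a1: "a \<ge> pi" unfolding a_def using pi_gt_zero by linarith
    note a = a1 a2
    note I = interval[OF N a]
    have "pi / N > 0" using N by simp
    then have I': "{2 / N * (a - pi / 2)<..<2 / N * (a + pi / 2)} \<subseteq> {0<..<pi}"
      using I by fastforce
    have h: "h_fun \<beta> n \<phi> = - F \<phi>" if "\<phi> \<in> {2 / N * (a - pi / 2)<..<2 / N * (a + pi / 2)}" for \<phi>
      using f_h_eq_resonance(2)[OF assms subsetD[OF I' that]] by (simp add: F_def N_def)
    note iter = arctan_iteration[of N a F, OF N n\<^sub>0[OF n, folded N_def, of _ pi, folded F_def, OF subsetD[OF I]]]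
    have ends: "2 / N * (a - pi / 2) = 2 * pi * real j / N" "2 / N * (a + pi / 2) = 2 * pi * (real j + 1) / N"
      using N by (simp_all add: a_def field_simps)
    have equation: "even_equation \<beta> n \<phi> \<longleftrightarrow> tan (N / 2 * \<phi> - a) = F \<phi>"
      if \<phi>: "\<phi> \<in> {2 / N * (a - pi / 2)<..<2 / N * (a + pi / 2)}" for \<phi>
    proof -
      define y where "y = N / 2 * \<phi> - a"
      have "- (pi / 2) < y" "y < pi / 2" using \<phi> N by (auto simp: y_def field_simps)
      then have y: "cos y > 0" by (rule cos_gt_zero_pi)
      \<comment> \<open>In terms of \<open>y\<close> the equation reads \<open>- sin y = h cos y\<close> with \<open>cos y > 0\<close>, so points with
        \<open>h = 0\<close> are not exceptional.\<close>
      have x: "real (n + 3) / 2 * \<phi> = pi * real j + (y + pi / 2)" by (simp add: y_def a_def N_def)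
      have "cos (real (n + 3) / 2 * \<phi>) = - ((- 1) ^ j * sin y)" "sin (real (n + 3) / 2 * \<phi>) = (- 1) ^ j * cos y"
        unfolding x by (simp_all add: cos_add sin_add mult.commute[of pi])
      then have "even_equation \<beta> n \<phi> \<longleftrightarrow> (- 1) ^ j * sin y = (- 1) ^ j * (F \<phi> * cos y)"
        unfolding even_equation_def h[OF \<phi>] by (simp add: mult_ac)
      also have "\<dots> \<longleftrightarrow> tan y = F \<phi>" using y by (simp add: tan_def field_simps)
      finally show ?thesis by (simp only: y_def)
    qed
    have root: "\<exists>!\<phi>. \<phi> \<in> {2 / N * (a - pi / 2)<..<2 / N * (a + pi / 2)} \<and> even_equation \<beta> n \<phi>"
      using iter(1) by (simp only: equation cong: conj_cong)
    have "even_iter \<beta> n j 0 = 2 / N * a"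
      by (simp add: d_node_def a_def N_def field_simps)
    moreover have "even_iter \<beta> n j (Suc k) = 2 / N * (a + arctan (F (even_iter \<beta> n j k)))"
      if "even_iter \<beta> n j k \<in> interior {2 / N * (a - pi / 2)..2 / N * (a + pi / 2)}" for k
      using h[OF that[unfolded interior_atLeastAtMost_real]]
      by (simp only: even_iter.simps a_def N_def arctan_minus minus_minus diff_minus_eq_add)
    ultimately have "\<bar>even_iter \<beta> n j (Suc k) - even_iter \<beta> n j k\<bar> \<le> pi / N * 0.8 ^ k" for k
      using iter(2)[of "even_iter \<beta> n j" k] by blast
    with root show "(\<exists>!\<phi>. \<phi> \<in> {2 * pi * real j / real (n + 3)<..<2 * pi * (real j + 1) / real (n + 3)} \<and>
             even_equation \<beta> n \<phi>) \<and>
       (\<forall>k. \<bar>even_iter \<beta> n j (Suc k) - even_iter \<beta> n j k\<bar> \<le> pi / real (n + 3) * 0.8 ^ k)"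
      unfolding ends unfolding N_def by blast
  qed
qed

end
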